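(* Let $\{1\}=G_0\subseteq G_1\subseteq\cdots\subseteq G_n=G$ be a chain of finite groups with branching graph $\Gamma$ and path algebras $P_0\subseteq\cdots\subseteq P_n$. For each $k$ let $Z_k=\{z_{k,j}\}_{1\le j\le r_k}$ be a set of central elements of $\mathbb{C}G_k$. The choice of an algebra isomorphism $\Phi:P_n\to\mathbb{C}G$ such that $\Phi(P_i)=\mathbb{C}G_i$ for all $0\le i\le n$ is determined by the choice of elements $\Phi(E_{ML})=e_{ML}\in\mathbb{C}G$ for each pair of paths $L,M$ in $\Gamma$ (with the same endpoint, so that $E_{ML}$ is defined). Assume that each path in $\Gamma$ is distinguished by its weight, i.e., if $L$ and $M$ are paths in $\Gamma$ and $L\ne M$, then $\mathrm{wt}(L)\neq\mathrm{wt}(M)$. Then: (a) For each path $L$ in $\Gamma$ the element $e_{LL}$ is determined uniquely by the elements $z_{k,j}\in Z_k$ and the constants $c_{k,j}(\mu)$, $\mu\in\hat G_k$, $0\le k\le n$. (b) If $M$ and $L$ are paths in $\Gamma$ (with the same endpoint) such that $M\neq L$, then $e_{ML}$ is determined up to a constant by the elements $z_{k,j}\in Z_k$ and the constants $c_{k,j}(\mu)$, $\mu\in\hat G_k$, $0\le k\le n$.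
   Context: Branching graph. $\hat G_i$ is an index set for the irreducible complex representations of $G_i$; the unique element of $\hat G_0$ is denoted $\emptyset$. For $\mu\in\hat G_{i-1}$, $\lambda\in\hat G_i$, let $c^\lambda_\mu$ be the multiplicity of the irreducible $G_{i-1}$-module $V^\mu$ in the restriction to $G_{i-1}$ of the irreducible $G_i$-module $V^\lambda$. The graph $\Gamma$ has vertices labeled by the elements of the sets $\hat G_i$, $0\le i\le n$, with $\mu\in\hat G_{i-1}$ and $\lambda\in\hat G_i$ joined by $c^\lambda_\mu$ edges. A path from $\emptyset$ to $\lambda\in\hat G_m$ is a sequence of $m$ edges $(\emptyset=\lambda^{(0)}\to\lambda^{(1)}\to\cdots\to\lambda^{(m)}=\lambda)$ with $\lambda^{(i)}\in\hat G_i$; paths using different edges are distinguished. $\mathcal{L}(\lambda)$ denotes the set of paths from $\emptyset$ to $\lambda$. "A path in $\Gamma$" means a path from $\emptyset$ to some element of $\hat G_n$. Path algebras. $P_m$ is the $\mathbb{C}$-algebra with basis $E_{ST}$, where $(S,T)$ runs over pairs of paths $S,T\in\mathcal{L}(\lambda)$, $\lambda\in\hat G_m$, and multiplication $E_{ST}E_{PQ}=\delta_{TP}E_{SQ}$. For $r<s$, $P_r$ is viewed inside $P_s$ by $E_{PQ}=\sum_T E_{P*T,\,Q*T}$, the sum over all paths $T$ from $\lambda\in\hat G_r$ (the common endpoint of $P,Q$) to any element of $\hat G_s$, where $*$ is concatenation. Weights. For $\mu\in\hat G_k$ put $c_{k,j}(\mu)=\chi^\mu(z_{k,j})/\chi^\mu(1)$,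 where $\chi^\mu$ is the irreducible character of $G_k$ indexed by $\mu$, and let $c_k(\mu)$ be the ordered $r_k$-tuple $(c_{k,j}(\mu))_{1\le j\le r_k}$. The weight of a path $L=(\lambda^{(0)}\to\cdots\to\lambda^{(n)})$ is $\mathrm{wt}(L)=(c_0(\lambda^{(0)}),\ldots,c_n(\lambda^{(n)}))$.
   Formalization: Φ is also required to respect labels: for each k and μ in Ĝ_k, V^μ pulled back along Φ is the irreducible P_k-module labelled μ. Without this (a) fails: for {1} ⊂ Z/2 with Z_1={g}, swapping the two blocks changes e_LL. *)

theory Defs
  imports "HOL-Algebra.QuotRing" "Jordan_Normal_Form.VS_Connect"
begin

section \<open>Group algebras and matrix representations\<close>

text \<open>\<open>\<complex>G\<close> consists of the complex functions on the ambient type that vanish outside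
  \<^term>\<open>carrier G\<close>; the product is convolution.  For a subgroup \<open>K\<close> the algebra \<open>\<complex>K\<close> is
  the group algebra of \<open>G\<lparr>carrier := K\<rparr>\<close>, and its carrier is literally a subset of that of \<open>\<complex>G\<close>.\<close>

definition group_algebra :: "('g, 'b) monoid_scheme \<Rightarrow> (complex, 'g \<Rightarrow> complex) module" where
  "group_algebra G =
     \<lparr> carrier = {x. \<forall>g. g \<notin> carrier G \<longrightarrow> x g = 0},
       mult = (\<lambda>x y g. \<Sum>(h, h') \<in> {(h, h'). h \<in> carrier G \<and> h' \<in> carrier G \<and> h \<otimes>\<^bsub>G\<^esub> h' = g}. x h * y h'),
       one = (\<lambda>g. if g = \<one>\<^bsub>G\<^esub> then 1 else 0),
       zero = (\<lambda>g. 0),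
       add = (\<lambda>x y g. x g + y g),
       smult = (\<lambda>a x g. a * x g) \<rparr>"

definition algebra_center :: "('a, 'x) module \<Rightarrow> 'x set" where
  "algebra_center A = {z \<in> carrier A. \<forall>x \<in> carrier A. z \<otimes>\<^bsub>A\<^esub> x = x \<otimes>\<^bsub>A\<^esub> z}"

definition algebra_iso :: "(complex, 'x) module \<Rightarrow> (complex, 'y) module \<Rightarrow> ('x \<Rightarrow> 'y) set" where
  "algebra_iso A B =
     {\<Phi> \<in> ring_iso A B. \<forall>a. \<forall>x \<in> carrier A. \<Phi> (a \<odot>\<^bsub>A\<^esub> x) = a \<odot>\<^bsub>B\<^esub> \<Phi> x}"

text \<open>A finite-dimensional complex representation of \<open>G\<close>, in coordinates: a map into square
  matrices whose values outside \<^term>\<open>carrier G\<close> are irrelevant.  Its degree is read off from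
  the image of the identity.\<close>

definition degree_rep :: "('g, 'b) monoid_scheme \<Rightarrow> ('g \<Rightarrow> complex mat) \<Rightarrow> nat" where
  "degree_rep G \<rho> = dim_row (\<rho> \<one>\<^bsub>G\<^esub>)"

definition is_rep :: "('g, 'b) monoid_scheme \<Rightarrow> ('g \<Rightarrow> complex mat) \<Rightarrow> bool" where
  "is_rep G \<rho> \<longleftrightarrow>
     \<rho> \<one>\<^bsub>G\<^esub> = 1\<^sub>m (degree_rep G \<rho>) \<and>
     (\<forall>g \<in> carrier G. \<rho> g \<in> carrier_mat (degree_rep G \<rho>) (degree_rep G \<rho>)) \<and>
     (\<forall>g \<in> carrier G. \<forall>h \<in> carrier G. \<rho> (g \<otimes>\<^bsub>G\<^esub> h) = \<rho> g * \<rho> h)"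

definition irreducible_rep :: "('g, 'b) monoid_scheme \<Rightarrow> ('g \<Rightarrow> complex mat) \<Rightarrow> bool" where
  "irreducible_rep G \<rho> \<longleftrightarrow>
     is_rep G \<rho> \<and> degree_rep G \<rho> > 0 \<and>
     (\<forall>W. VectorSpace.subspace class_ring W (module_vec TYPE(complex) (degree_rep G \<rho>)) \<longrightarrow>
        (\<forall>g \<in> carrier G. \<forall>w \<in> W. \<rho> g *\<^sub>v w \<in> W) \<longrightarrow>
        W = {0\<^sub>v (degree_rep G \<rho>)} \<or> W = carrier_vec (degree_rep G \<rho>))"

definition equiv_rep :: "'x set \<Rightarrow> ('x \<Rightarrow> complex mat) \<Rightarrow> ('x \<Rightarrow> complex mat) \<Rightarrow> bool" where
  "equiv_rep X \<rho> \<sigma> \<longleftrightarrow> (\<exists>P Q. \<forall>x \<in> X. similar_mat_wit (\<rho> x) (\<sigma> x) P Q)"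

text \<open>The linear extension of a representation to the group algebra, and its trace.\<close>

definition extend_rep ::
    "('g, 'b) monoid_scheme \<Rightarrow> ('g \<Rightarrow> complex mat) \<Rightarrow> ('g \<Rightarrow> complex) \<Rightarrow> complex mat" where
  "extend_rep G \<rho> x =
     mat (degree_rep G \<rho>) (degree_rep G \<rho>) (\<lambda>(i, j). \<Sum>g \<in> carrier G. x g * \<rho> g $$ (i, j))"

definition rep_character ::
    "('g, 'b) monoid_scheme \<Rightarrow> ('g \<Rightarrow> complex mat) \<Rightarrow> ('g \<Rightarrow> complex) \<Rightarrow> complex" where
  "rep_character G \<rho> x = (\<Sum>i < degree_rep G \<rho>. extend_rep G \<rho> x $$ (i, i))"

section \<open>Chains of groups and branching graphs\<close>

definition group_chain :: "('g, 'b) monoid_scheme \<Rightarrow> nat \<Rightarrow> (nat \<Rightarrow> 'g set) \<Rightarrow> bool" where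
  "group_chain G n H \<longleftrightarrow>
     group G \<and> finite (carrier G) \<and> (\<forall>k \<le> n. subgroup (H k) G) \<and>
     H 0 = {\<one>\<^bsub>G\<^esub>} \<and> H n = carrier G \<and> (\<forall>k < n. H k \<subseteq> H (Suc k))"

text \<open>\<open>edges \<Gamma> k \<mu> \<nu>\<close> is the number of edges joining \<open>\<mu>\<close> on level \<open>k\<close> to \<open>\<nu>\<close> on level
  \<open>k + 1\<close>; these edges are numbered \<open>0, 1, \<dots>\<close>.\<close>

record 'i level_graph =
  levels :: "nat \<Rightarrow> 'i set"
  edges :: "nat \<Rightarrow> 'i \<Rightarrow> 'i \<Rightarrow> nat"

text \<open>\<open>labels_irreps K I \<rho>\<close>: \<open>I\<close> is an index set for the irreducible representations of the
  finite group \<open>K\<close>, with \<open>\<rho> \<mu>\<close> a representative of the class labelled \<open>\<mu>\<close>.  The finiteness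
  of \<open>I\<close> is automatic and is recorded only for convenience.\<close>

definition labels_irreps ::
    "('g, 'b) monoid_scheme \<Rightarrow> 'i set \<Rightarrow> ('i \<Rightarrow> 'g \<Rightarrow> complex mat) \<Rightarrow> bool" where
  "labels_irreps K I \<rho> \<longleftrightarrow>
     finite I \<and>
     (\<forall>\<mu> \<in> I. irreducible_rep K (\<rho> \<mu>)) \<and>
     (\<forall>\<mu> \<in> I. \<forall>\<nu> \<in> I. equiv_rep (carrier K) (\<rho> \<mu>) (\<rho> \<nu>) \<longrightarrow> \<mu> = \<nu>) \<and>
     (\<forall>\<sigma>. irreducible_rep K \<sigma> \<longrightarrow> (\<exists>\<mu> \<in> I. equiv_rep (carrier K) \<sigma> (\<rho> \<mu>)))"

text \<open>The multiplicity condition says that \<open>V\<^sup>\<nu>\<close>, restricted to the smaller group, is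
  isomorphic to a direct sum of irreducibles in which \<open>V\<^sup>\<mu>\<close> occurs \<open>edges \<Gamma> k \<mu> \<nu>\<close> times.\<close>

definition is_branching_graph ::
    "('g, 'b) monoid_scheme \<Rightarrow> nat \<Rightarrow> (nat \<Rightarrow> 'g set) \<Rightarrow> 'i level_graph \<Rightarrow>
     (nat \<Rightarrow> 'i \<Rightarrow> 'g \<Rightarrow> complex mat) \<Rightarrow> bool" where
  "is_branching_graph G n H \<Gamma> V \<longleftrightarrow>
     (\<forall>k \<le> n. labels_irreps (G\<lparr>carrier := H k\<rparr>) (levels \<Gamma> k) (V k)) \<and>
     (\<forall>k < n. \<forall>\<nu> \<in> levels \<Gamma> (Suc k). \<exists>\<mu>s.
        set \<mu>s \<subseteq> levels \<Gamma> k \<and>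
        (\<forall>\<mu> \<in> levels \<Gamma> k. count_list \<mu>s \<mu> = edges \<Gamma> k \<mu> \<nu>) \<and>
        equiv_rep (H k) (V (Suc k) \<nu>) (\<lambda>g. diag_block_mat (map (\<lambda>\<mu>. V k \<mu> g) \<mu>s)))"

section \<open>Paths and path algebras\<close>

text \<open>A path is stored as the list of its edges, each given by its number and its target; the
  source is the target of the preceding edge, or the starting vertex.\<close>

type_synonym 'i gpath = "(nat \<times> 'i) list"

fun is_walk :: "'i level_graph \<Rightarrow> nat \<Rightarrow> 'i \<Rightarrow> 'i gpath \<Rightarrow> bool" where
  "is_walk \<Gamma> k \<mu> [] \<longleftrightarrow> \<mu> \<in> levels \<Gamma> k"
| "is_walk \<Gamma> k \<mu> ((e, \<nu>) # L) \<longleftrightarrow>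
     \<mu> \<in> levels \<Gamma> k \<and> e < edges \<Gamma> k \<mu> \<nu> \<and> is_walk \<Gamma> (Suc k) \<nu> L"

text \<open>For \<open>r \<le> s\<close>: the paths from \<open>\<mu>\<close> on level \<open>r\<close> to any vertex on level \<open>s\<close>.\<close>

definition walks :: "'i level_graph \<Rightarrow> nat \<Rightarrow> 'i \<Rightarrow> nat \<Rightarrow> 'i gpath set" where
  "walks \<Gamma> r \<mu> s = {L. length L = s - r \<and> is_walk \<Gamma> r \<mu> L}"

text \<open>The vertex written \<open>\<emptyset>\<close>; level 0 of a branching graph is a singleton.\<close>

definition root_vertex :: "'i level_graph \<Rightarrow> 'i" where
  "root_vertex \<Gamma> = the_elem (levels \<Gamma> 0)"

definition paths :: "'i level_graph \<Rightarrow> nat \<Rightarrow> 'i gpath set" where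
  "paths \<Gamma> m = walks \<Gamma> 0 (root_vertex \<Gamma>) m"

definition path_vertex :: "'i level_graph \<Rightarrow> 'i gpath \<Rightarrow> nat \<Rightarrow> 'i" where
  "path_vertex \<Gamma> L k = (root_vertex \<Gamma> # map snd L) ! k"

definition endpoint :: "'i level_graph \<Rightarrow> 'i gpath \<Rightarrow> 'i" where
  "endpoint \<Gamma> L = path_vertex \<Gamma> L (length L)"

definition paths_to :: "'i level_graph \<Rightarrow> nat \<Rightarrow> 'i \<Rightarrow> 'i gpath set" where
  "paths_to \<Gamma> m \<mu> = {L \<in> paths \<Gamma> m. endpoint \<Gamma> L = \<mu>}"

definition path_pairs :: "'i level_graph \<Rightarrow> nat \<Rightarrow> ('i gpath \<times> 'i gpath) set" where
  "path_pairs \<Gamma> m = {(S, T). S \<in> paths \<Gamma> m \<and> T \<in> paths \<Gamma> m \<and> endpoint \<Gamma> S = endpoint \<Gamma> T}"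

text \<open>An element of \<open>P\<^sub>m\<close> is given by its coordinates \<open>x S T\<close> in the basis \<open>E\<^sub>S\<^sub>T\<close>.\<close>

definition path_unit :: "'i gpath \<Rightarrow> 'i gpath \<Rightarrow> 'i gpath \<Rightarrow> 'i gpath \<Rightarrow> complex" where
  "path_unit S T = (\<lambda>A B. if A = S \<and> B = T then 1 else 0)"

definition path_algebra ::
    "'i level_graph \<Rightarrow> nat \<Rightarrow> (complex, 'i gpath \<Rightarrow> 'i gpath \<Rightarrow> complex) module" where
  "path_algebra \<Gamma> m =
     \<lparr> carrier = {x. \<forall>S T. (S, T) \<notin> path_pairs \<Gamma> m \<longrightarrow> x S T = 0},
       mult = (\<lambda>x y S Q. \<Sum>T \<in> paths \<Gamma> m. x S T * y T Q),
       one = (\<lambda>S T. if S \<in> paths \<Gamma> m \<and> S = T then 1 else 0),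
       zero = (\<lambda>S T. 0),
       add = (\<lambda>x y S T. x S T + y S T),
       smult = (\<lambda>a x S T. a * x S T) \<rparr>"

text \<open>The multiplication is the bilinear extension of \<open>E\<^sub>S\<^sub>T E\<^sub>P\<^sub>Q = \<delta>\<^sub>T\<^sub>P E\<^sub>S\<^sub>Q\<close>.\<close>

lemma path_unit_mult:
  assumes "finite (paths \<Gamma> m)" and "(S, T) \<in> path_pairs \<Gamma> m" and "(P, Q) \<in> path_pairs \<Gamma> m"
  shows "path_unit S T \<otimes>\<^bsub>path_algebra \<Gamma> m\<^esub> path_unit P Q =
    (if T = P then path_unit S Q else \<zero>\<^bsub>path_algebra \<Gamma> m\<^esub>)"
proof -
  have *: "(\<Sum>U \<in> paths \<Gamma> m. (if A = S \<and> U = T then 1 else 0) * (if U = P \<and> B = Q then 1 else 0))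
      = (if T = P \<and> A = S \<and> B = Q then 1 else (0::complex))" for A B
  proof -
    have "(\<Sum>U \<in> paths \<Gamma> m. (if A = S \<and> U = T then 1 else 0) * (if U = P \<and> B = Q then 1 else (0::complex)))
      = (\<Sum>U \<in> paths \<Gamma> m. if U = T then (if T = P \<and> A = S \<and> B = Q then 1 else 0) else 0)"
      by (rule sum.cong) auto
    also have "\<dots> = (if T = P \<and> A = S \<and> B = Q then 1 else 0)"
      using assms by (simp add: sum.delta path_pairs_def)
    finally show ?thesis .
  qed
  show ?thesis
    by (intro ext) (auto simp: path_algebra_def path_unit_def *)
qed

text \<open>The inclusion \<open>P\<^sub>r \<subseteq> P\<^sub>s\<close>: the linear map
  \<open>E\<^sub>P\<^sub>Q \<mapsto> \<Sum>\<^sub>T E\<^sub>P\<^sub>T\<^sub>,\<^sub>Q\<^sub>T\<close>, over the paths \<open>T\<close> from the common endpoint to level \<open>s\<close>.\<close>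

definition path_embed ::
    "'i level_graph \<Rightarrow> nat \<Rightarrow> nat \<Rightarrow> ('i gpath \<Rightarrow> 'i gpath \<Rightarrow> complex) \<Rightarrow>
     ('i gpath \<Rightarrow> 'i gpath \<Rightarrow> complex)" where
  "path_embed \<Gamma> r s x = (\<lambda>A B.
     \<Sum>(P, Q) \<in> path_pairs \<Gamma> r. x P Q *
       (\<Sum>T \<in> walks \<Gamma> r (endpoint \<Gamma> P) s. path_unit (P @ T) (Q @ T) A B))"

text \<open>The irreducible \<open>P\<^sub>m\<close>-module labelled \<open>\<mu>\<close>, with basis \<open>v\<^sub>S\<close> for the paths \<open>S\<close> to \<open>\<mu>\<close>
  (listed without repetition in \<open>Ss\<close>) and action \<open>E\<^sub>S\<^sub>T v\<^sub>U = \<delta>\<^sub>T\<^sub>U v\<^sub>S\<close>.\<close>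

definition path_rep ::
    "'i gpath list \<Rightarrow> ('i gpath \<Rightarrow> 'i gpath \<Rightarrow> complex) \<Rightarrow> complex mat" where
  "path_rep Ss x = mat (length Ss) (length Ss) (\<lambda>(i, j). x (Ss ! i) (Ss ! j))"

text \<open>Isomorphisms \<open>P\<^sub>n \<rightarrow> \<complex>G\<close> with \<open>\<Phi>(P\<^sub>k) = \<complex>G\<^sub>k\<close> that respect the labelling: pulled back
  along \<open>\<Phi>\<close>, the \<open>\<complex>G\<^sub>k\<close>-module \<open>V\<^sup>\<mu>\<close> is the \<open>P\<^sub>k\<close>-module labelled \<open>\<mu>\<close>.  Without the last
  clause \<open>\<Phi>\<close> could interchange two matrix blocks of the same size, whose labels (and hence
  the constants attached to them) differ.\<close>

definition branching_isos ::
    "('g, 'b) monoid_scheme \<Rightarrow> nat \<Rightarrow> (nat \<Rightarrow> 'g set) \<Rightarrow> 'i level_graph \<Rightarrow>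
     (nat \<Rightarrow> 'i \<Rightarrow> 'g \<Rightarrow> complex mat) \<Rightarrow>
     (('i gpath \<Rightarrow> 'i gpath \<Rightarrow> complex) \<Rightarrow> ('g \<Rightarrow> complex)) set" where
  "branching_isos G n H \<Gamma> V =
     {\<Phi> \<in> algebra_iso (path_algebra \<Gamma> n) (group_algebra G).
        (\<forall>k \<le> n. \<Phi> ` path_embed \<Gamma> k n ` carrier (path_algebra \<Gamma> k) =
                 carrier (group_algebra (G\<lparr>carrier := H k\<rparr>))) \<and>
        (\<forall>k \<le> n. \<forall>\<mu> \<in> levels \<Gamma> k. \<exists>Ss. distinct Ss \<and> set Ss = paths_to \<Gamma> k \<mu> \<and>
           equiv_rep (carrier (path_algebra \<Gamma> k))
             (\<lambda>x. extend_rep (G\<lparr>carrier := H k\<rparr>) (V k \<mu>) (\<Phi> (path_embed \<Gamma> k n x)))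
             (path_rep Ss))}"

section \<open>Weights\<close>

text \<open>The tuple \<open>c\<^sub>k(\<mu>)\<close>, where \<open>Z k\<close> lists the elements \<open>z\<^sub>k\<^sub>,\<^sub>1, \<dots>, z\<^sub>k\<^sub>,\<^sub>r\<close>.\<close>

definition central_values ::
    "('g, 'b) monoid_scheme \<Rightarrow> (nat \<Rightarrow> 'g set) \<Rightarrow> (nat \<Rightarrow> 'i \<Rightarrow> 'g \<Rightarrow> complex mat) \<Rightarrow>
     (nat \<Rightarrow> ('g \<Rightarrow> complex) list) \<Rightarrow> nat \<Rightarrow> 'i \<Rightarrow> complex list" where
  "central_values G H V Z k \<mu> =
     (let Gk = G\<lparr>carrier := H k\<rparr> in
      map (\<lambda>z. rep_character Gk (V k \<mu>) z /
               rep_character Gk (V k \<mu>) \<one>\<^bsub>group_algebra Gk\<^esub>) (Z k))"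

definition path_weight ::
    "('g, 'b) monoid_scheme \<Rightarrow> nat \<Rightarrow> (nat \<Rightarrow> 'g set) \<Rightarrow> 'i level_graph \<Rightarrow>
     (nat \<Rightarrow> 'i \<Rightarrow> 'g \<Rightarrow> complex mat) \<Rightarrow> (nat \<Rightarrow> ('g \<Rightarrow> complex) list) \<Rightarrow>
     'i gpath \<Rightarrow> complex list list" where
  "path_weight G n H \<Gamma> V Z L =
     map (\<lambda>k. central_values G H V Z k (path_vertex \<Gamma> L k)) [0..<Suc n]"

end

theory Submission
  imports Defs
begin

text \<open>A central element \<open>z = \<Phi>(x)\<close> of \<open>\<complex>G\<^sub>k\<close> with \<open>x \<in> P\<^sub>k\<close> acts on the irreducible module
  labelled \<open>\<mu>\<close> by the scalar \<open>\<chi>\<^sup>\<mu>(z) / \<chi>\<^sup>\<mu>(1)\<close>, so in \<open>P\<^sub>n\<close> it is the diagonal element whose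
  entry at a path \<open>L\<close> is the corresponding entry of the weight of \<open>L\<close>.  Hence two isomorphisms with
  the same constants have the same preimages of all \<open>z\<^sub>k\<^sub>,\<^sub>j\<close>.  As weights separate paths,
  Lagrange interpolation writes every \<open>E\<^sub>L\<^sub>L\<close> as a polynomial in these preimages, so the two
  isomorphisms agree on \<open>E\<^sub>L\<^sub>L\<close>.  Finally \<open>e\<^sub>M\<^sub>L\<close> lies in
  \<open>e\<^sub>M\<^sub>M \<complex>G e\<^sub>L\<^sub>L\<close>, which is a line.\<close>

section \<open>Scalar action of central elements\<close>

lemma extend_rep_carrier: "extend_rep K \<rho> x \<in> carrier_mat (degree_rep K \<rho>) (degree_rep K \<rho>)"
  by (simp add: extend_rep_def)

lemma extend_rep_one:
  assumes "group K" "finite (carrier K)" "is_rep K \<rho>"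
  shows "extend_rep K \<rho> \<one>\<^bsub>group_algebra K\<^esub> = 1\<^sub>m (degree_rep K \<rho>)"
proof -
  have 1: "\<one>\<^bsub>K\<^esub> \<in> carrier K"
    using assms(1) by (simp add: group.is_monoid monoid.one_closed)
  have "(\<Sum>g\<in>carrier K. \<one>\<^bsub>group_algebra K\<^esub> g * \<rho> g $$ (i, j)) = \<rho> \<one>\<^bsub>K\<^esub> $$ (i, j)" for i j
  proof -
    have "(\<Sum>g\<in>carrier K. \<one>\<^bsub>group_algebra K\<^esub> g * \<rho> g $$ (i, j))
        = (\<Sum>g\<in>carrier K. if g = \<one>\<^bsub>K\<^esub> then \<rho> g $$ (i, j) else 0)"
      by (rule sum.cong) (auto simp: group_algebra_def)
    then show ?thesis
      using 1 assms(2) by simp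
  qed
  moreover have "\<rho> \<one>\<^bsub>K\<^esub> = 1\<^sub>m (degree_rep K \<rho>)"
    using assms(3) by (simp add: is_rep_def)
  ultimately show ?thesis
    by (intro eq_matI) (simp_all add: extend_rep_def)
qed

text \<open>Pairs of group elements are partitioned by their product, so the convolution sums over
  fibres combine into a free double sum, in which the homomorphism property of \<open>\<rho>\<close>
  factors every entry.\<close>

lemma extend_rep_mult:
  assumes "group K" "finite (carrier K)" "is_rep K \<rho>"
  shows "extend_rep K \<rho> (x \<otimes>\<^bsub>group_algebra K\<^esub> y) = extend_rep K \<rho> x * extend_rep K \<rho> y"
proof (rule eq_matI)
  let ?d = "degree_rep K \<rho>" and ?C = "carrier K"
  fix i j
  assume "i < dim_row (extend_rep K \<rho> x * extend_rep K \<rho> y)"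
    and "j < dim_col (extend_rep K \<rho> x * extend_rep K \<rho> y)"
  then have ij: "i < ?d" "j < ?d"
    by (auto simp: extend_rep_def)
  have hom: "\<rho> (g \<otimes>\<^bsub>K\<^esub> h) $$ (i, j) = (\<Sum>l<?d. \<rho> g $$ (i, l) * \<rho> h $$ (l, j))"
    if "g \<in> ?C" "h \<in> ?C" for g h
  proof -
    have "\<rho> g \<in> carrier_mat ?d ?d" "\<rho> h \<in> carrier_mat ?d ?d" "\<rho> (g \<otimes>\<^bsub>K\<^esub> h) = \<rho> g * \<rho> h"
      using assms(3) that by (auto simp: is_rep_def)
    then show ?thesis
      using ij by (auto simp: scalar_prod_def atLeast0LessThan)
  qed
  \<comment> \<open>\<open>sum.group\<close> expects each fibre as a filtered subset of one product
    set.\<close>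
  have fibre: "{(h, h'). h \<in> ?C \<and> h' \<in> ?C \<and> h \<otimes>\<^bsub>K\<^esub> h' = g}
      = {p \<in> ?C \<times> ?C. fst p \<otimes>\<^bsub>K\<^esub> snd p = g}" for g
    by auto
  have "extend_rep K \<rho> (x \<otimes>\<^bsub>group_algebra K\<^esub> y) $$ (i, j)
      = (\<Sum>g\<in>?C. \<Sum>p\<in>{p \<in> ?C \<times> ?C. fst p \<otimes>\<^bsub>K\<^esub> snd p = g}.
          x (fst p) * y (snd p) * \<rho> (fst p \<otimes>\<^bsub>K\<^esub> snd p) $$ (i, j))"
    using ij
    by (auto simp: extend_rep_def group_algebra_def fibre sum_distrib_right case_prod_beta
        intro!: sum.cong)
  also have "\<dots> = (\<Sum>p\<in>?C \<times> ?C. x (fst p) * y (snd p) * \<rho> (fst p \<otimes>\<^bsub>K\<^esub> snd p) $$ (i, j))"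
    using assms(1,2) by (intro sum.group) (auto simp: group.is_monoid monoid.m_closed)
  also have "\<dots> = (\<Sum>g\<in>?C. \<Sum>h\<in>?C. x g * y h * \<rho> (g \<otimes>\<^bsub>K\<^esub> h) $$ (i, j))"
    by (simp add: sum.cartesian_product case_prod_beta)
  also have "\<dots> = (\<Sum>g\<in>?C. \<Sum>h\<in>?C. \<Sum>l<?d. (x g * \<rho> g $$ (i, l)) * (y h * \<rho> h $$ (l, j)))"
    by (intro sum.cong refl) (auto simp: hom sum_distrib_left mult_ac)
  also have "\<dots> = (\<Sum>g\<in>?C. \<Sum>l<?d. \<Sum>h\<in>?C. (x g * \<rho> g $$ (i, l)) * (y h * \<rho> h $$ (l, j)))"
    by (intro sum.cong refl sum.swap)
  also have "\<dots> = (\<Sum>l<?d. \<Sum>g\<in>?C. \<Sum>h\<in>?C. (x g * \<rho> g $$ (i, l)) * (y h * \<rho> h $$ (l, j)))"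
    by (rule sum.swap)
  also have "\<dots> = (\<Sum>l<?d. (\<Sum>g\<in>?C. x g * \<rho> g $$ (i, l)) * (\<Sum>h\<in>?C. y h * \<rho> h $$ (l, j)))"
    by (simp add: sum_product)
  also have "\<dots> = (extend_rep K \<rho> x * extend_rep K \<rho> y) $$ (i, j)"
    using ij by (simp add: extend_rep_def scalar_prod_def atLeast0LessThan)
  finally show "extend_rep K \<rho> (x \<otimes>\<^bsub>group_algebra K\<^esub> y) $$ (i, j)
      = (extend_rep K \<rho> x * extend_rep K \<rho> y) $$ (i, j)" .
qed (simp_all add: extend_rep_def)

section \<open>Schur's lemma by matrix units\<close>

text \<open>Conjugation by one fixed pair \<open>P\<close>, \<open>Q\<close> is multiplicative
  because the inner \<open>P * Q\<close> cancels. Since \<open>equiv_rep\<close> gives the same pair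
  for all algebra elements, commutation passes from the group side to the path side.\<close>

lemma similar_commute:
  assumes "similar_mat_wit A B P Q" "similar_mat_wit A' B' P Q" "A * A' = A' * A"
  shows "B * B' = B' * B"
proof -
  define d where "d = dim_row A"
  note AB = similar_mat_witD[OF d_def assms(1)]
  \<comment> \<open>Both similarities share \<open>P\<close>, whose size forces \<open>A'\<close> to
    have the size of \<open>A\<close>.\<close>
  have "dim_row A' = d"
    using AB(6) similar_mat_witD(6)[OF refl assms(2)] by auto
  note AB' = similar_mat_witD[OF this[symmetric] assms(2)]
  have B: "B = Q * A * P" "B' = Q * A' * P"
    using similar_mat_witD(3)[OF refl similar_mat_wit_sym[OF assms(1)]]
      similar_mat_witD(3)[OF refl similar_mat_wit_sym[OF assms(2)]] by simp_all
  have *: "(Q * X * P) * (Q * Y * P) = Q * (X * Y) * P"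
    if "X \<in> carrier_mat d d" "Y \<in> carrier_mat d d" for X Y
  proof -
    have "(Q * X * P) * (Q * Y * P) = Q * X * ((P * Q) * (Y * P))"
      using that AB(6,7) by (simp add: assoc_mult_mat[of _ d d _ d _ d])
    then show ?thesis
      using that AB(6,7) by (simp add: AB(1) assoc_mult_mat[of _ d d _ d _ d])
  qed
  show ?thesis
    unfolding B using *[OF AB(4) AB'(4)] *[OF AB'(4) AB(4)] assms(3) by simp
qed

lemma path_rep_unit:
  assumes "distinct Ss" "i < length Ss" "j < length Ss" "a < length Ss" "b < length Ss"
  shows "path_rep Ss (path_unit (Ss ! i) (Ss ! j)) $$ (a, b) = (if a = i \<and> b = j then 1 else 0)"
  using assms by (auto simp: path_rep_def path_unit_def nth_eq_iff_index_eq)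

text \<open>On the basis \<open>Ss\<close> the units \<open>path_unit S T\<close> act as the
  elementary matrices, and a matrix commuting with all of these is scalar. The second conclusion
  reads the scalar back as coordinates of \<open>x\<close>.\<close>

lemma path_rep_scalar:
  assumes "distinct Ss"
    and comm: "\<And>S T. S \<in> set Ss \<Longrightarrow> T \<in> set Ss \<Longrightarrow>
      path_rep Ss x * path_rep Ss (path_unit S T) = path_rep Ss (path_unit S T) * path_rep Ss x"
  obtains c where "path_rep Ss x = c \<cdot>\<^sub>m 1\<^sub>m (length Ss)"
    and "\<And>S T. S \<in> set Ss \<Longrightarrow> T \<in> set Ss \<Longrightarrow> x S T = (if S = T then c else 0)"
proof -
  let ?N = "length Ss"
  \<comment> \<open>Entry \<open>(a, b)\<close> of the commutation with the elementary matrix at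
    \<open>(i, j)\<close>, each product collapsed to a single term.\<close>
  have key: "x (Ss ! a) (Ss ! i) * (if b = j then 1 else 0)
      = (if a = i then 1 else 0) * x (Ss ! j) (Ss ! b)"
    if "i < ?N" "j < ?N" "a < ?N" "b < ?N" for i j a b
  proof -
    have "(path_rep Ss x * path_rep Ss (path_unit (Ss ! i) (Ss ! j))) $$ (a, b)
        = (\<Sum>l<?N. x (Ss ! a) (Ss ! l) * (if l = i \<and> b = j then 1 else 0))"
      using that path_rep_unit[OF assms(1), of i j]
      by (auto simp: scalar_prod_def atLeast0LessThan path_rep_def intro!: sum.cong)
    also have "\<dots> = (\<Sum>l<?N. if l = i then x (Ss ! a) (Ss ! i) * (if b = j then 1 else 0) else 0)"
      by (rule sum.cong) auto
    also have "\<dots> = x (Ss ! a) (Ss ! i) * (if b = j then 1 else 0)"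
      using that by simp
    finally have 1: "(path_rep Ss x * path_rep Ss (path_unit (Ss ! i) (Ss ! j))) $$ (a, b) = \<dots>" .
    have "(path_rep Ss (path_unit (Ss ! i) (Ss ! j)) * path_rep Ss x) $$ (a, b)
        = (\<Sum>l<?N. (if a = i \<and> l = j then 1 else 0) * x (Ss ! l) (Ss ! b))"
      using that path_rep_unit[OF assms(1), of i j]
      by (auto simp: scalar_prod_def atLeast0LessThan path_rep_def intro!: sum.cong)
    also have "\<dots> = (\<Sum>l<?N. if l = j then (if a = i then 1 else 0) * x (Ss ! j) (Ss ! b) else 0)"
      by (rule sum.cong) auto
    also have "\<dots> = (if a = i then 1 else 0) * x (Ss ! j) (Ss ! b)"
      using that by simp
    finally show ?thesis
      using 1 comm[of "Ss ! i" "Ss ! j"] that by simp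
  qed
  \<comment> \<open>The scalar is read off at the first path. For empty \<open>Ss\<close> its value
    is arbitrary and both conclusions are trivial.\<close>
  define c where "c = x (Ss ! 0) (Ss ! 0)"
  have ent: "x (Ss ! a) (Ss ! b) = (if a = b then c else 0)" if "a < ?N" "b < ?N" for a b
  proof -
    have "0 < ?N"
      using that by linarith
    \<comment> \<open>The first instance equates every diagonal entry with \<open>c\<close>; the
      second kills the entries with \<open>a \<noteq> b\<close>.\<close>
    then show ?thesis
      using that key[of a 0 a 0] key[of b b a b] by (auto simp: c_def)
  qed
  show ?thesis
  proof
    show "path_rep Ss x = c \<cdot>\<^sub>m 1\<^sub>m ?N"
      by (rule eq_matI) (auto simp: path_rep_def ent)
    show "x S T = (if S = T then c else 0)" if "S \<in> set Ss" "T \<in> set Ss" for S T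
      using that ent assms(1) by (auto simp: in_set_conv_nth nth_eq_iff_index_eq)
  qed
qed

lemma path_unit_carrier: "(S, T) \<in> path_pairs \<Gamma> m \<Longrightarrow> path_unit S T \<in> carrier (path_algebra \<Gamma> m)"
  by (auto simp: path_algebra_def path_unit_def)

lemma rep_character_scalar:
  assumes "extend_rep K \<rho> x = c \<cdot>\<^sub>m 1\<^sub>m (degree_rep K \<rho>)"
  shows "rep_character K \<rho> x = c * of_nat (degree_rep K \<rho>)"
  using assms by (simp add: rep_character_def)

lemma branching_isosD:
  assumes "\<Phi> \<in> branching_isos G n H \<Gamma> V"
  shows "\<Phi> \<in> algebra_iso (path_algebra \<Gamma> n) (group_algebra G)"
    and "k \<le> n \<Longrightarrow> \<Phi> ` path_embed \<Gamma> k n ` carrier (path_algebra \<Gamma> k) =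
      carrier (group_algebra (G\<lparr>carrier := H k\<rparr>))"
    and "k \<le> n \<Longrightarrow> \<mu> \<in> levels \<Gamma> k \<Longrightarrow> \<exists>Ss. distinct Ss \<and> set Ss = paths_to \<Gamma> k \<mu> \<and>
      equiv_rep (carrier (path_algebra \<Gamma> k))
        (\<lambda>x. extend_rep (G\<lparr>carrier := H k\<rparr>) (V k \<mu>) (\<Phi> (path_embed \<Gamma> k n x))) (path_rep Ss)"
  using assms by (auto simp: branching_isos_def)

text \<open>A central element commutes with the images of all units on paths to
  \<open>\<mu>\<close>, so it acts as a scalar on that module. Its trace divided by the trace of the
  identity recovers this scalar.\<close>

lemma central_preimage_scalar:
  assumes chain: "group_chain G n H" and graph: "is_branching_graph G n H \<Gamma> V"
    and iso: "\<Phi> \<in> branching_isos G n H \<Gamma> V" and k: "k \<le> n" and \<mu>: "\<mu> \<in> levels \<Gamma> k"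
    and x: "x \<in> carrier (path_algebra \<Gamma> k)"
    and z: "\<Phi> (path_embed \<Gamma> k n x) \<in> algebra_center (group_algebra (G\<lparr>carrier := H k\<rparr>))"
    and ST: "S \<in> paths_to \<Gamma> k \<mu>" "T \<in> paths_to \<Gamma> k \<mu>"
  defines "K \<equiv> G\<lparr>carrier := H k\<rparr>"
  shows "x S T = (if S = T then rep_character K (V k \<mu>) (\<Phi> (path_embed \<Gamma> k n x)) /
      rep_character K (V k \<mu>) \<one>\<^bsub>group_algebra K\<^esub> else 0)"
proof -
  have sub: "subgroup (H k) G" and "group G" "finite (carrier G)"
    using chain k by (auto simp: group_chain_def)
  then have K: "group K" "finite (carrier K)"
    by (auto simp: K_def subgroup.subgroup_is_group intro: finite_subset[OF subgroup.subset])
  have "irreducible_rep K (V k \<mu>)"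
    using graph k \<mu> by (auto simp: is_branching_graph_def labels_irreps_def K_def)
  then have rep: "is_rep K (V k \<mu>)" and pos: "degree_rep K (V k \<mu>) > 0"
    by (auto simp: irreducible_rep_def)
  define d where "d = degree_rep K (V k \<mu>)"
  define R where "R y = extend_rep K (V k \<mu>) (\<Phi> (path_embed \<Gamma> k n y))" for y
  have R_carrier: "R y \<in> carrier_mat d d" for y
    by (simp add: R_def d_def extend_rep_carrier)
  obtain Ss P Q where Ss: "distinct Ss" "set Ss = paths_to \<Gamma> k \<mu>"
    and sim: "\<And>y. y \<in> carrier (path_algebra \<Gamma> k) \<Longrightarrow> similar_mat_wit (R y) (path_rep Ss y) P Q"
    using branching_isosD(3)[OF iso k \<mu>] unfolding equiv_rep_def R_def K_def by blast
  have comm: "R x * R y = R y * R x" if "y \<in> carrier (path_algebra \<Gamma> k)" for y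
  proof -
    have "\<Phi> (path_embed \<Gamma> k n y) \<in> carrier (group_algebra K)"
      using branching_isosD(2)[OF iso k] that by (auto simp: K_def)
    then have "\<Phi> (path_embed \<Gamma> k n x) \<otimes>\<^bsub>group_algebra K\<^esub> \<Phi> (path_embed \<Gamma> k n y)
        = \<Phi> (path_embed \<Gamma> k n y) \<otimes>\<^bsub>group_algebra K\<^esub> \<Phi> (path_embed \<Gamma> k n x)"
      using z[folded K_def] by (simp add: algebra_center_def)
    then show ?thesis
      unfolding R_def by (metis extend_rep_mult[OF K rep])
  qed
  obtain c where c: "path_rep Ss x = c \<cdot>\<^sub>m 1\<^sub>m (length Ss)"
    and ent: "\<And>S T. S \<in> set Ss \<Longrightarrow> T \<in> set Ss \<Longrightarrow> x S T = (if S = T then c else 0)"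
  proof (rule path_rep_scalar[OF Ss(1)])
    fix S T assume "S \<in> set Ss" "T \<in> set Ss"
    then have "path_unit S T \<in> carrier (path_algebra \<Gamma> k)"
      by (intro path_unit_carrier) (auto simp: Ss paths_to_def path_pairs_def)
    then show "path_rep Ss x * path_rep Ss (path_unit S T)
        = path_rep Ss (path_unit S T) * path_rep Ss x"
      using similar_commute[OF sim[OF x] sim comm] by blast
  qed (rule that)
  have PQ: "P \<in> carrier_mat d d" "Q \<in> carrier_mat d d" "P * Q = 1\<^sub>m d"
    "path_rep Ss x \<in> carrier_mat d d" "R x = P * path_rep Ss x * Q"
    using sim[OF x] R_carrier[of x] by (auto simp: similar_mat_wit_def Let_def)
  \<comment> \<open>Similar matrices have equal size: the paths to \<open>\<mu>\<close> are as many
    as the dimension of its module.\<close>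
  then have "length Ss = d"
    by (auto simp: path_rep_def)
  then have "R x = c \<cdot>\<^sub>m 1\<^sub>m d"
    using PQ c by (simp add: mult_smult_distrib[of _ d d _ d] mult_smult_assoc_mat[of _ d d _ d])
  then have "rep_character K (V k \<mu>) (\<Phi> (path_embed \<Gamma> k n x)) = c * of_nat d"
    unfolding R_def d_def by (rule rep_character_scalar)
  moreover have "rep_character K (V k \<mu>) \<one>\<^bsub>group_algebra K\<^esub> = 1 * of_nat d"
    unfolding d_def by (intro rep_character_scalar) (auto simp: extend_rep_one[OF K rep])
  moreover have "d > 0"
    using pos by (simp add: d_def)
  moreover have "x S T = (if S = T then c else 0)"
    using ent ST Ss(2) by blast
  ultimately show ?thesis
    by simp
qed

section \<open>Diagonal elements of the path algebra\<close>

lemma is_walk_start: "is_walk \<Gamma> k \<mu> L \<Longrightarrow> \<mu> \<in> levels \<Gamma> k"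
  by (cases L) auto

lemma is_walk_append:
  "is_walk \<Gamma> k \<mu> (L @ T) \<longleftrightarrow>
    is_walk \<Gamma> k \<mu> L \<and> is_walk \<Gamma> (k + length L) ((\<mu> # map snd L) ! length L) T"
proof (induction L arbitrary: k \<mu>)
  case Nil
  then show ?case
    by (auto dest: is_walk_start)
qed auto

text \<open>Induction on the length: the first edge has its target in the finite next level and its
  number below a multiplicity. Only levels between \<open>r\<close> and \<open>s\<close> are assumed
  finite, as a branching graph is controlled only up to level \<open>n\<close>.\<close>

lemma finite_walks:
  assumes "\<And>j. r \<le> j \<Longrightarrow> j \<le> s \<Longrightarrow> finite (levels \<Gamma> j)"
  shows "finite (walks \<Gamma> r \<mu> s)"
proof -
  have "finite {L. length L = m \<and> is_walk \<Gamma> r \<mu> L}"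
    if "\<And>j. r \<le> j \<Longrightarrow> j \<le> r + m \<Longrightarrow> finite (levels \<Gamma> j)" for m r \<mu>
    using that
  proof (induction m arbitrary: r \<mu>)
    case 0
    have "{L. length L = 0 \<and> is_walk \<Gamma> r \<mu> L} \<subseteq> {[]}"
      by auto
    then show ?case
      by (rule finite_subset) simp
  next
    case (Suc m)
    have "{L. length L = Suc m \<and> is_walk \<Gamma> r \<mu> L} \<subseteq>
        (\<Union>\<nu>\<in>levels \<Gamma> (Suc r). \<Union>e\<in>{..<edges \<Gamma> r \<mu> \<nu>}.
          (#) (e, \<nu>) ` {L. length L = m \<and> is_walk \<Gamma> (Suc r) \<nu> L})"
    proof
      fix L assume L: "L \<in> {L. length L = Suc m \<and> is_walk \<Gamma> r \<mu> L}"
      then obtain e \<nu> L' where "L = (e, \<nu>) # L'"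
        by (cases L) auto
      then show "L \<in> (\<Union>\<nu>\<in>levels \<Gamma> (Suc r). \<Union>e\<in>{..<edges \<Gamma> r \<mu> \<nu>}.
          (#) (e, \<nu>) ` {L. length L = m \<and> is_walk \<Gamma> (Suc r) \<nu> L})"
        using L is_walk_start[of \<Gamma> "Suc r" \<nu> L'] by auto
    qed
    moreover have "finite {L. length L = m \<and> is_walk \<Gamma> (Suc r) \<nu> L}" for \<nu>
      using Suc.prems by (intro Suc.IH) simp
    moreover have "finite (levels \<Gamma> (Suc r))"
      using Suc.prems by simp
    ultimately show ?case
      by (elim finite_subset) (intro finite_UN_I finite_imageI, auto)
  qed
  then show ?thesis
  proof (cases "r \<le> s")
    \<comment> \<open>For \<open>s < r\<close> the truncated difference \<open>s - r\<close> is 0,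
      which leaves at most the empty walk.\<close>
    case False
    have "walks \<Gamma> r \<mu> s \<subseteq> {[]}"
      using False by (auto simp: walks_def)
    then show ?thesis
      by (rule finite_subset) simp
  qed (use assms in \<open>auto simp: walks_def\<close>)
qed

lemma append_mem_paths:
  assumes "k \<le> m" "length P = k"
  shows "P @ T \<in> paths \<Gamma> m \<longleftrightarrow> P \<in> paths \<Gamma> k \<and> T \<in> walks \<Gamma> k (endpoint \<Gamma> P) m"
  using assms by (auto simp: paths_def walks_def is_walk_append endpoint_def path_vertex_def)

lemma path_take_drop:
  assumes "L \<in> paths \<Gamma> m" "k \<le> m"
  shows "take k L \<in> paths \<Gamma> k" and "drop k L \<in> walks \<Gamma> k (endpoint \<Gamma> (take k L)) m"
    and "endpoint \<Gamma> (take k L) = path_vertex \<Gamma> L k"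
proof -
  have len: "length L = m"
    using assms(1) by (simp add: paths_def walks_def)
  then show "take k L \<in> paths \<Gamma> k" "drop k L \<in> walks \<Gamma> k (endpoint \<Gamma> (take k L)) m"
    using append_mem_paths[of k m "take k L" "drop k L" \<Gamma>] assms by auto
  show "endpoint \<Gamma> (take k L) = path_vertex \<Gamma> L k"
    using len assms(2) by (cases k) (auto simp: endpoint_def path_vertex_def)
qed

lemma path_vertex_mem_levels:
  assumes "L \<in> paths \<Gamma> m" "k \<le> m"
  shows "path_vertex \<Gamma> L k \<in> levels \<Gamma> k"
  using path_take_drop(2,3)[OF assms] by (auto simp: walks_def dest: is_walk_start)

lemma endpoint_mem_levels:
  assumes "L \<in> paths \<Gamma> m"
  shows "endpoint \<Gamma> L \<in> levels \<Gamma> m"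
  using path_vertex_mem_levels[OF assms order_refl] assms
  by (simp add: endpoint_def paths_def walks_def)

section \<open>The diagonal subalgebra\<close>

text \<open>The diagonal subalgebra in function form: pointwise operations on functions of paths
  become algebra operations, so polynomials in central elements can be handled as polynomials in
  numbers.\<close>

definition path_diag :: "'i level_graph \<Rightarrow> nat \<Rightarrow> ('i gpath \<Rightarrow> complex) \<Rightarrow> 'i gpath \<Rightarrow> 'i gpath \<Rightarrow> complex"
  where "path_diag \<Gamma> m f = (\<lambda>S T. if S \<in> paths \<Gamma> m \<and> S = T then f S else 0)"

lemma path_diag_carrier: "path_diag \<Gamma> m f \<in> carrier (path_algebra \<Gamma> m)"
  by (auto simp: path_diag_def path_algebra_def path_pairs_def)

lemma path_diag_one: "path_diag \<Gamma> m (\<lambda>_. 1) = \<one>\<^bsub>path_algebra \<Gamma> m\<^esub>"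
  by (auto simp: path_diag_def path_algebra_def)

lemma path_diag_add:
  "path_diag \<Gamma> m (\<lambda>L. f L + g L) = path_diag \<Gamma> m f \<oplus>\<^bsub>path_algebra \<Gamma> m\<^esub> path_diag \<Gamma> m g"
  by (auto simp: path_diag_def path_algebra_def intro!: ext)

lemma path_diag_smult:
  "path_diag \<Gamma> m (\<lambda>L. a * f L) = a \<odot>\<^bsub>path_algebra \<Gamma> m\<^esub> path_diag \<Gamma> m f"
  by (auto simp: path_diag_def path_algebra_def intro!: ext)

lemma path_diag_mult:
  assumes "finite (paths \<Gamma> m)"
  shows "path_diag \<Gamma> m (\<lambda>L. f L * g L) = path_diag \<Gamma> m f \<otimes>\<^bsub>path_algebra \<Gamma> m\<^esub> path_diag \<Gamma> m g"
proof (intro ext)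
  fix S Q
  have "(\<Sum>T\<in>paths \<Gamma> m. path_diag \<Gamma> m f S T * path_diag \<Gamma> m g T Q)
      = (\<Sum>T\<in>paths \<Gamma> m. if T = S then (if S = Q then f S * g S else 0) else 0)"
    by (rule sum.cong) (auto simp: path_diag_def)
  then show "path_diag \<Gamma> m (\<lambda>L. f L * g L) S Q
      = (path_diag \<Gamma> m f \<otimes>\<^bsub>path_algebra \<Gamma> m\<^esub> path_diag \<Gamma> m g) S Q"
    using assms by (auto simp: path_diag_def path_algebra_def)
qed

lemma path_diag_cong:
  "(\<And>L. L \<in> paths \<Gamma> m \<Longrightarrow> f L = g L) \<Longrightarrow> path_diag \<Gamma> m f = path_diag \<Gamma> m g"
  by (auto simp: path_diag_def intro!: ext)

lemma path_diag_unit: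
  "L \<in> paths \<Gamma> m \<Longrightarrow> path_diag \<Gamma> m (\<lambda>M. if M = L then 1 else 0) = path_unit L L"
  by (auto simp: path_diag_def path_unit_def intro!: ext)

text \<open>Extending a path leaves its part up to level \<open>k\<close> unchanged, so an element
  that is scalar on each block of level \<open>k\<close> stays diagonal on level \<open>m\<close>
  and sees of \<open>L\<close> only its vertex at level \<open>k\<close>.\<close>

lemma path_embed_diagonal:
  assumes fin: "finite (paths \<Gamma> k)" "\<And>\<mu>. finite (walks \<Gamma> k \<mu> m)" and km: "k \<le> m"
    and x: "\<And>S T. (S, T) \<in> path_pairs \<Gamma> k \<Longrightarrow> x S T = (if S = T then c (endpoint \<Gamma> S) else 0)"
  shows "path_embed \<Gamma> k m x = path_diag \<Gamma> m (\<lambda>L. c (path_vertex \<Gamma> L k))"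
proof (intro ext)
  fix A B
  let ?E = "\<lambda>P Q. \<Sum>T\<in>walks \<Gamma> k (endpoint \<Gamma> P) m. path_unit (P @ T) (Q @ T) A B"
  \<comment> \<open>Only \<open>T = drop k A\<close> can extend \<open>P\<close> to
    \<open>A\<close>, so the inner sum is a single indicator.\<close>
  have E: "?E P P = (if P = take k A then path_diag \<Gamma> m (\<lambda>_. 1) A B else 0)" if P: "P \<in> paths \<Gamma> k" for P
  proof -
    have len: "length P = k"
      using P by (simp add: paths_def walks_def)
    have eq: "A = P @ T \<longleftrightarrow> P = take k A \<and> T = drop k A" for T
      by (metis append_eq_conv_conj len)
    have "?E P P = (\<Sum>T\<in>walks \<Gamma> k (endpoint \<Gamma> P) m.
        if T = drop k A then (if P = take k A \<and> A = B then 1 else 0) else 0)"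
      by (rule sum.cong) (use eq in \<open>auto simp: path_unit_def\<close>)
    also have "\<dots> = (if drop k A \<in> walks \<Gamma> k (endpoint \<Gamma> P) m \<and> P = take k A \<and> A = B then 1 else 0)"
      using fin(2) by simp
    also have "\<dots> = (if P = take k A then path_diag \<Gamma> m (\<lambda>_. 1) A B else 0)"
      using append_mem_paths[OF km len, of "drop k A" \<Gamma>] P by (auto simp: path_diag_def)
    finally show ?thesis .
  qed
  have finp: "finite (path_pairs \<Gamma> k)"
    by (rule finite_subset[of _ "paths \<Gamma> k \<times> paths \<Gamma> k"]) (auto simp: path_pairs_def fin)
  have "path_embed \<Gamma> k m x A B = (\<Sum>p\<in>path_pairs \<Gamma> k. x (fst p) (snd p) * ?E (fst p) (snd p))"
    by (simp add: path_embed_def case_prod_beta)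
  also have "\<dots> = (\<Sum>p\<in>(\<lambda>P. (P, P)) ` paths \<Gamma> k. x (fst p) (snd p) * ?E (fst p) (snd p))"
  proof (rule sum.mono_neutral_right[OF finp])
    show "(\<lambda>P. (P, P)) ` paths \<Gamma> k \<subseteq> path_pairs \<Gamma> k"
      by (auto simp: path_pairs_def)
    show "\<forall>p\<in>path_pairs \<Gamma> k - (\<lambda>P. (P, P)) ` paths \<Gamma> k. x (fst p) (snd p) * ?E (fst p) (snd p) = 0"
    proof
      fix p assume p: "p \<in> path_pairs \<Gamma> k - (\<lambda>P. (P, P)) ` paths \<Gamma> k"
      then have "fst p \<noteq> snd p"
        by (auto simp: path_pairs_def)
      then have "x (fst p) (snd p) = 0"
        using x[of "fst p" "snd p"] p by simp
      then show "x (fst p) (snd p) * ?E (fst p) (snd p) = 0"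
        by simp
    qed
  qed
  also have "\<dots> = (\<Sum>P\<in>paths \<Gamma> k. x P P * ?E P P)"
    by (subst sum.reindex) (auto simp: inj_on_def)
  also have "\<dots> = (\<Sum>P\<in>paths \<Gamma> k.
      if P = take k A then c (endpoint \<Gamma> (take k A)) * path_diag \<Gamma> m (\<lambda>_. 1) A B else 0)"
    by (rule sum.cong) (auto simp: E x path_pairs_def)
  also have "\<dots> = (if take k A \<in> paths \<Gamma> k
      then c (endpoint \<Gamma> (take k A)) * path_diag \<Gamma> m (\<lambda>_. 1) A B else 0)"
    using fin(1) by simp
  \<comment> \<open>If \<open>take k A\<close> is not a path, neither is \<open>A\<close>, and both
    sides vanish.\<close>
  also have "\<dots> = path_diag \<Gamma> m (\<lambda>L. c (path_vertex \<Gamma> L k)) A B"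
    using path_take_drop(1,3)[OF _ km, of A \<Gamma>] by (auto simp: path_diag_def)
  finally show "path_embed \<Gamma> k m x A B = path_diag \<Gamma> m (\<lambda>L. c (path_vertex \<Gamma> L k)) A B" .
qed

lemma branching_graph_finite_levels:
  "is_branching_graph G n H \<Gamma> V \<Longrightarrow> k \<le> n \<Longrightarrow> finite (levels \<Gamma> k)"
  by (auto simp: is_branching_graph_def labels_irreps_def)

text \<open>\<open>\<Phi>\<close> carries the embedded \<open>P\<^sub>k\<close> onto the group
  algebra of \<open>H k\<close>, so the central element has a preimage from level \<open>k\<close>,
  which is scalar on each block. The resulting diagonal element is built from the graph and the
  constants alone, which makes two isomorphisms comparable.\<close>

lemma iso_path_diag_central:
  assumes chain: "group_chain G n H" and graph: "is_branching_graph G n H \<Gamma> V"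
    and iso: "\<Phi> \<in> branching_isos G n H \<Gamma> V" and k: "k \<le> n" and j: "j < length (Z k)"
    and z: "Z k ! j \<in> algebra_center (group_algebra (G\<lparr>carrier := H k\<rparr>))"
  shows "\<Phi> (path_diag \<Gamma> n (\<lambda>L. central_values G H V Z k (path_vertex \<Gamma> L k) ! j)) = Z k ! j"
proof -
  have "Z k ! j \<in> carrier (group_algebra (G\<lparr>carrier := H k\<rparr>))"
    using z by (simp add: algebra_center_def)
  then obtain x where x: "x \<in> carrier (path_algebra \<Gamma> k)" and xz: "Z k ! j = \<Phi> (path_embed \<Gamma> k n x)"
    unfolding branching_isosD(2)[OF iso k, symmetric] by blast
  have "path_embed \<Gamma> k n x = path_diag \<Gamma> n (\<lambda>L. central_values G H V Z k (path_vertex \<Gamma> L k) ! j)"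
  proof (rule path_embed_diagonal[OF _ _ k])
    show "finite (paths \<Gamma> k)" "finite (walks \<Gamma> k \<mu> n)" for \<mu>
      using branching_graph_finite_levels[OF graph] k by (auto simp: paths_def intro!: finite_walks)
    fix S T assume ST: "(S, T) \<in> path_pairs \<Gamma> k"
    then have "S \<in> paths_to \<Gamma> k (endpoint \<Gamma> S)" "T \<in> paths_to \<Gamma> k (endpoint \<Gamma> S)"
      "endpoint \<Gamma> S \<in> levels \<Gamma> k"
      by (auto simp: path_pairs_def paths_to_def endpoint_mem_levels)
    then show "x S T = (if S = T then central_values G H V Z k (endpoint \<Gamma> S) ! j else 0)"
      using central_preimage_scalar[OF chain graph iso k _ x] z j
      by (simp add: central_values_def Let_def xz)
  qed
  then show ?thesis
    using xz by simp
qed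

section \<open>Interpolation and sandwiching\<close>

text \<open>Lagrange interpolation, one node at a time. Different nodes may be separated from
  \<open>L\<close> by different members of \<open>D\<close>, just as weights of paths may differ at
  different levels.\<close>

lemma interpolation:
  fixes D :: "('p \<Rightarrow> 'k::field) set"
  assumes "finite F" and "L \<notin> F"
    and one: "(\<lambda>_. 1) \<in> D"
    and add: "\<And>f g. f \<in> D \<Longrightarrow> g \<in> D \<Longrightarrow> (\<lambda>x. f x + g x) \<in> D"
    and mult: "\<And>f g. f \<in> D \<Longrightarrow> g \<in> D \<Longrightarrow> (\<lambda>x. f x * g x) \<in> D"
    and smult: "\<And>a f. f \<in> D \<Longrightarrow> (\<lambda>x. a * f x) \<in> D"
    and sep: "\<And>M. M \<in> F \<Longrightarrow> \<exists>f\<in>D. f L \<noteq> f M"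
  shows "\<exists>f\<in>D. f L = 1 \<and> (\<forall>M\<in>F. f M = 0)"
  using \<open>finite F\<close> \<open>L \<notin> F\<close> sep
proof (induction F rule: finite_induct)
  case empty
  then show ?case
    using one by auto
next
  case (insert M F)
  then obtain f where f: "f \<in> D" "f L = 1" "\<forall>N\<in>F. f N = 0"
    by auto
  obtain g where g: "g \<in> D" "g L \<noteq> g M"
    using insert.prems by auto
  \<comment> \<open>The second factor is affine in \<open>g\<close>, with value 1 at
    \<open>L\<close> and 0 at \<open>M\<close>; the first keeps the zeros on \<open>F\<close>.
    Writing \<open>- g M * 1\<close> fits the closure rules.\<close>
  let ?h = "\<lambda>x. f x * (inverse (g L - g M) * (g x + - g M * 1))"
  have "?h \<in> D"
    by (intro mult smult add f g one)
  moreover have "?h L = 1 \<and> (\<forall>N\<in>insert M F. ?h N = 0)"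
    using f g(2) by auto
  ultimately show ?case
    by meson
qed

section \<open>Corners of the path algebra and comparison of isomorphisms\<close>

lemma path_algebra_mult_closed:
  assumes "x \<in> carrier (path_algebra \<Gamma> m)" "y \<in> carrier (path_algebra \<Gamma> m)"
  shows "x \<otimes>\<^bsub>path_algebra \<Gamma> m\<^esub> y \<in> carrier (path_algebra \<Gamma> m)"
proof -
  have "x S T * y T Q = 0" if "(S, Q) \<notin> path_pairs \<Gamma> m" for S T Q
  proof -
    \<comment> \<open>Having a common endpoint is transitive.\<close>
    have "(S, T) \<notin> path_pairs \<Gamma> m \<or> (T, Q) \<notin> path_pairs \<Gamma> m"
      using that by (auto simp: path_pairs_def)
    then show ?thesis
      using assms by (auto simp: path_algebra_def)
  qed
  then show ?thesis
    by (simp add: path_algebra_def)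
qed

text \<open>Left multiplication by \<open>path_unit M M\<close> keeps only row \<open>M\<close>,
  right multiplication by \<open>path_unit L L\<close> only column \<open>L\<close>; the corner is
  therefore a line.\<close>

lemma path_unit_sandwich:
  assumes "finite (paths \<Gamma> m)" "M \<in> paths \<Gamma> m" "L \<in> paths \<Gamma> m"
  shows "path_unit M M \<otimes>\<^bsub>path_algebra \<Gamma> m\<^esub> (x \<otimes>\<^bsub>path_algebra \<Gamma> m\<^esub> path_unit L L)
      = x M L \<odot>\<^bsub>path_algebra \<Gamma> m\<^esub> path_unit M L"
proof -
  have right: "(x \<otimes>\<^bsub>path_algebra \<Gamma> m\<^esub> path_unit L L) S Q = (if Q = L then x S L else 0)" for S Q
  proof -
    have "(x \<otimes>\<^bsub>path_algebra \<Gamma> m\<^esub> path_unit L L) S Q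
        = (\<Sum>T\<in>paths \<Gamma> m. if T = L then (if Q = L then x S L else 0) else 0)"
      by (auto simp: path_algebra_def path_unit_def intro!: sum.cong)
    then show ?thesis
      using assms by simp
  qed
  have left: "(path_unit M M \<otimes>\<^bsub>path_algebra \<Gamma> m\<^esub> y) S Q = (if S = M then y M Q else 0)" for y S Q
  proof -
    have "(path_unit M M \<otimes>\<^bsub>path_algebra \<Gamma> m\<^esub> y) S Q
        = (\<Sum>T\<in>paths \<Gamma> m. if T = M then (if S = M then y M Q else 0) else 0)"
      by (auto simp: path_algebra_def path_unit_def intro!: sum.cong)
    then show ?thesis
      using assms by simp
  qed
  show ?thesis
    by (intro ext) (simp only: left right, simp add: path_algebra_def path_unit_def)
qed

lemma algebra_isoD:
  assumes "\<Phi> \<in> algebra_iso A B"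
  shows "\<Phi> \<one>\<^bsub>A\<^esub> = \<one>\<^bsub>B\<^esub>" and "bij_betw \<Phi> (carrier A) (carrier B)"
    and "x \<in> carrier A \<Longrightarrow> \<Phi> (a \<odot>\<^bsub>A\<^esub> x) = a \<odot>\<^bsub>B\<^esub> \<Phi> x"
    and "x \<in> carrier A \<Longrightarrow> y \<in> carrier A \<Longrightarrow> \<Phi> (x \<otimes>\<^bsub>A\<^esub> y) = \<Phi> x \<otimes>\<^bsub>B\<^esub> \<Phi> y"
    and "x \<in> carrier A \<Longrightarrow> y \<in> carrier A \<Longrightarrow> \<Phi> (x \<oplus>\<^bsub>A\<^esub> y) = \<Phi> x \<oplus>\<^bsub>B\<^esub> \<Phi> y"
  using assms
  by (auto simp: algebra_iso_def ring_iso_def ring_hom_one ring_hom_mult ring_hom_add)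

text \<open>The units span the algebra: \<open>x\<close> is assembled from its truncations
  \<open>r F\<close>, one coordinate at a time.\<close>

lemma algebra_iso_determined_by_path_units:
  assumes \<Phi>: "\<Phi> \<in> algebra_iso (path_algebra \<Gamma> m) B" and \<Phi>': "\<Phi>' \<in> algebra_iso (path_algebra \<Gamma> m) B"
    and fin: "finite (paths \<Gamma> m)"
    and eq: "\<And>S T. (S, T) \<in> path_pairs \<Gamma> m \<Longrightarrow> \<Phi> (path_unit S T) = \<Phi>' (path_unit S T)"
    and x: "x \<in> carrier (path_algebra \<Gamma> m)"
  shows "\<Phi> x = \<Phi>' x"
proof -
  let ?A = "path_algebra \<Gamma> m"
  define r where "r F = (\<lambda>S T. if (S, T) \<in> F then x S T else 0)" for F
  have r_carrier: "r F \<in> carrier ?A" if "F \<subseteq> path_pairs \<Gamma> m" for F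
    using that by (auto simp: r_def path_algebra_def)
  have "\<Phi> (r F) = \<Phi>' (r F)" if "finite F" "F \<subseteq> path_pairs \<Gamma> m" for F
    using that
  proof (induction F rule: finite_induct)
    case empty
    \<comment> \<open>Zero is written as a multiple of the identity, so preservation of the identity
      and of scalars settles the empty truncation.\<close>
    have "r {} = 0 \<odot>\<^bsub>?A\<^esub> \<one>\<^bsub>?A\<^esub>"
      by (simp add: r_def path_algebra_def)
    moreover have "\<one>\<^bsub>?A\<^esub> \<in> carrier ?A"
      using path_diag_carrier by (simp flip: path_diag_one)
    ultimately show ?case
      by (simp add: algebra_isoD(1,3)[OF \<Phi>] algebra_isoD(1,3)[OF \<Phi>'])
  next
    case (insert p F)
    obtain S T where p: "p = (S, T)"
      by (cases p)
    have ST: "(S, T) \<in> path_pairs \<Gamma> m" "(S, T) \<notin> F"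
      using insert p by auto
    then have u: "path_unit S T \<in> carrier ?A"
      by (simp add: path_unit_carrier)
    then have su: "x S T \<odot>\<^bsub>?A\<^esub> path_unit S T \<in> carrier ?A"
      by (simp add: path_algebra_def)
    have "r (insert p F) = (x S T \<odot>\<^bsub>?A\<^esub> path_unit S T) \<oplus>\<^bsub>?A\<^esub> r F"
      using ST(2) by (auto simp: p r_def path_algebra_def path_unit_def intro!: ext)
    then show ?case
      using insert su u r_carrier[of F] eq[OF ST(1)]
      by (simp add: algebra_isoD(3,5)[OF \<Phi>] algebra_isoD(3,5)[OF \<Phi>'])
  qed
  moreover have "finite (path_pairs \<Gamma> m)"
    by (rule finite_subset[of _ "paths \<Gamma> m \<times> paths \<Gamma> m"]) (auto simp: path_pairs_def fin)
  moreover have "r (path_pairs \<Gamma> m) = x"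
    using x by (auto simp: r_def path_algebra_def intro!: ext)
  ultimately show ?thesis
    by blast
qed

text \<open>Agreeing on the two diagonal units, both isomorphisms map the corner between them onto
  the same line of the group algebra, and each image of \<open>path_unit M L\<close> spans that
  line.\<close>

lemma algebra_iso_path_unit_up_to_scalar:
  assumes \<Phi>: "\<Phi> \<in> algebra_iso (path_algebra \<Gamma> m) (group_algebra G)"
    and \<Phi>': "\<Phi>' \<in> algebra_iso (path_algebra \<Gamma> m) (group_algebra G)"
    and fin: "finite (paths \<Gamma> m)" and pair: "(M, L) \<in> path_pairs \<Gamma> m"
    and eq: "\<Phi> (path_unit M M) = \<Phi>' (path_unit M M)" "\<Phi> (path_unit L L) = \<Phi>' (path_unit L L)"
  shows "\<exists>a. a \<noteq> 0 \<and> \<Phi> (path_unit M L) = a \<odot>\<^bsub>group_algebra G\<^esub> \<Phi>' (path_unit M L)"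
proof -
  let ?A = "path_algebra \<Gamma> m" and ?B = "group_algebra G"
  have paths: "M \<in> paths \<Gamma> m" "L \<in> paths \<Gamma> m"
    using pair by (auto simp: path_pairs_def)
  have u: "path_unit M M \<in> carrier ?A" "path_unit L L \<in> carrier ?A" "path_unit M L \<in> carrier ?A"
    using pair by (auto simp: path_pairs_def intro!: path_unit_carrier)
  have sandwich: "\<Psi> (path_unit M M) \<otimes>\<^bsub>?B\<^esub> (\<Psi> x \<otimes>\<^bsub>?B\<^esub> \<Psi> (path_unit L L))
      = x M L \<odot>\<^bsub>?B\<^esub> \<Psi> (path_unit M L)"
    if "\<Psi> \<in> algebra_iso ?A ?B" "x \<in> carrier ?A" for \<Psi> x
    using arg_cong[OF path_unit_sandwich[OF fin paths, of x], of \<Psi>] that u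
    by (simp add: algebra_isoD(3,4)[OF that(1)] path_algebra_mult_closed)
  have "\<Phi> (path_unit M L) \<in> carrier ?B"
    using algebra_isoD(2)[OF \<Phi>] u by (auto simp: bij_betw_def)
  \<comment> \<open>Pulling the element back along \<open>\<Phi>'\<close> gives it coordinates; the
    required scalar is \<open>w M L\<close>.\<close>
  then obtain w where w: "w \<in> carrier ?A" "\<Phi> (path_unit M L) = \<Phi>' w"
    using algebra_isoD(2)[OF \<Phi>'] unfolding bij_betw_def by blast
  \<comment> \<open>The inserted coordinate equals 1 and gives the expression the shape of the
    sandwich for \<open>\<Phi>\<close>.\<close>
  have "\<Phi> (path_unit M L) = path_unit M L M L \<odot>\<^bsub>?B\<^esub> \<Phi> (path_unit M L)"
    by (simp add: path_unit_def group_algebra_def)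
  also have "\<dots> = w M L \<odot>\<^bsub>?B\<^esub> \<Phi>' (path_unit M L)"
    using sandwich[OF \<Phi> u(3)] sandwich[OF \<Phi>' w(1)] w(2) eq by simp
  finally have *: "\<Phi> (path_unit M L) = w M L \<odot>\<^bsub>?B\<^esub> \<Phi>' (path_unit M L)" .
  \<comment> \<open>With scalar zero, \<open>\<Phi>\<close> would identify the unit with zero,
    against injectivity.\<close>
  moreover have "w M L \<noteq> 0"
  proof
    assume "w M L = 0"
    then have "\<Phi> (path_unit M L) = 0 \<odot>\<^bsub>?B\<^esub> \<Phi> (path_unit M L)"
      using * by (simp add: group_algebra_def)
    also have "\<dots> = \<Phi> (0 \<odot>\<^bsub>?A\<^esub> path_unit M L)"
      using u by (simp add: algebra_isoD(3)[OF \<Phi>])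
    finally have "path_unit M L = 0 \<odot>\<^bsub>?A\<^esub> path_unit M L"
      using algebra_isoD(2)[OF \<Phi>] u by (auto simp: bij_betw_def path_algebra_def dest!: inj_onD)
    then have "path_unit M L M L = (0 \<odot>\<^bsub>?A\<^esub> path_unit M L) M L"
      by (rule fun_cong[OF fun_cong])
    then show False
      by (simp add: path_unit_def path_algebra_def)
  qed
  ultimately show ?thesis
    by blast
qed

text \<open>Being determined by given data is expressed by comparing two choices that share these
  data; the representing matrices and the isomorphism may vary.\<close>

theorem proposition1p12:
  fixes G :: "('g, 'b) monoid_scheme"
    and n :: nat
    and H :: "nat \<Rightarrow> 'g set"
    and \<Gamma> :: "'i level_graph"
    and V V' :: "nat \<Rightarrow> 'i \<Rightarrow> 'g \<Rightarrow> complex mat"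
    and Z :: "nat \<Rightarrow> ('g \<Rightarrow> complex) list"
    and \<Phi> \<Phi>' :: "('i gpath \<Rightarrow> 'i gpath \<Rightarrow> complex) \<Rightarrow> ('g \<Rightarrow> complex)"
  assumes chain: "group_chain G n H"
    and graph: "is_branching_graph G n H \<Gamma> V"
    and central: "\<And>k z. k \<le> n \<Longrightarrow> z \<in> set (Z k) \<Longrightarrow>
                    z \<in> algebra_center (group_algebra (G\<lparr>carrier := H k\<rparr>))"
    and weights: "\<And>L M. L \<in> paths \<Gamma> n \<Longrightarrow> M \<in> paths \<Gamma> n \<Longrightarrow> L \<noteq> M \<Longrightarrow>
                    path_weight G n H \<Gamma> V Z L \<noteq> path_weight G n H \<Gamma> V Z M"
    and iso: "\<Phi> \<in> branching_isos G n H \<Gamma> V"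
    \<comment> \<open>a second choice, with the same elements \<open>Z\<close> and the same constants\<close>
    and graph': "is_branching_graph G n H \<Gamma> V'"
    and same_constants: "\<And>k \<mu>. k \<le> n \<Longrightarrow> \<mu> \<in> levels \<Gamma> k \<Longrightarrow>
                    central_values G H V Z k \<mu> = central_values G H V' Z k \<mu>"
    and iso': "\<Phi>' \<in> branching_isos G n H \<Gamma> V'"
  shows
    \<comment> \<open>the isomorphism is determined by the elements \<open>\<Phi> E\<^sub>M\<^sub>L\<close>\<close>
    "((\<forall>(M, L) \<in> path_pairs \<Gamma> n. \<Phi> (path_unit M L) = \<Phi>' (path_unit M L)) \<longrightarrow>
        (\<forall>x \<in> carrier (path_algebra \<Gamma> n). \<Phi> x = \<Phi>' x))
     \<and> (\<forall>L \<in> paths \<Gamma> n. \<Phi> (path_unit L L) = \<Phi>' (path_unit L L))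
     \<and> (\<forall>(M, L) \<in> path_pairs \<Gamma> n. M \<noteq> L \<longrightarrow>
          (\<exists>a::complex. a \<noteq> 0 \<and>
             \<Phi> (path_unit M L) = a \<odot>\<^bsub>group_algebra G\<^esub> \<Phi>' (path_unit M L)))"
proof -
  have fin: "finite (paths \<Gamma> n)"
    using branching_graph_finite_levels[OF graph] by (auto simp: paths_def intro!: finite_walks)
  note \<Phi> = branching_isosD(1)[OF iso] and \<Phi>' = branching_isosD(1)[OF iso']
  \<comment> \<open>As both isomorphisms respect the algebra operations, the functions on whose
    diagonal elements they agree form an algebra under pointwise operations.\<close>
  define D where "D = {f. \<Phi> (path_diag \<Gamma> n f) = \<Phi>' (path_diag \<Gamma> n f)}"
  have weight_mem: "(\<lambda>L. central_values G H V Z k (path_vertex \<Gamma> L k) ! j) \<in> D"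
    if k: "k \<le> n" and j: "j < length (Z k)" for k j
  proof -
    have z: "Z k ! j \<in> algebra_center (group_algebra (G\<lparr>carrier := H k\<rparr>))"
      using central k j by simp
    \<comment> \<open>Equal constants at all path vertices give one diagonal element, which both
      isomorphisms send to \<open>Z k ! j\<close>.\<close>
    have "path_diag \<Gamma> n (\<lambda>L. central_values G H V Z k (path_vertex \<Gamma> L k) ! j)
        = path_diag \<Gamma> n (\<lambda>L. central_values G H V' Z k (path_vertex \<Gamma> L k) ! j)"
      using k by (intro path_diag_cong) (simp add: same_constants path_vertex_mem_levels)
    then show ?thesis
      using iso_path_diag_central[where Z = Z, OF chain graph iso k j z]
        iso_path_diag_central[where Z = Z, OF chain graph' iso' k j z]
      by (simp add: D_def)
  qed
  have separated: "\<exists>f\<in>D. f L \<noteq> f M" if LM: "L \<in> paths \<Gamma> n" "M \<in> paths \<Gamma> n" "L \<noteq> M" for L M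
  proof -
    obtain k where k: "k \<le> n"
      and ne: "central_values G H V Z k (path_vertex \<Gamma> L k)
        \<noteq> central_values G H V Z k (path_vertex \<Gamma> M k)"
      using weights[OF LM] by (auto simp: path_weight_def less_Suc_eq_le simp del: upt_Suc)
    \<comment> \<open>Tuples of equal length that differ do so in some entry
      \<open>j\<close>.\<close>
    have "length (central_values G H V Z k \<mu>) = length (Z k)" for \<mu>
      by (simp add: central_values_def Let_def)
    then obtain j where j: "j < length (Z k)"
      and nth_ne: "central_values G H V Z k (path_vertex \<Gamma> L k) ! j
        \<noteq> central_values G H V Z k (path_vertex \<Gamma> M k) ! j"
      using ne by (metis nth_equalityI)
    show ?thesis
      using nth_ne by (rule bexI[OF _ weight_mem[OF k j]])
  qed
  have diagonal: "\<Phi> (path_unit L L) = \<Phi>' (path_unit L L)" if L: "L \<in> paths \<Gamma> n" for L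
  proof -
    have "\<exists>f\<in>D. f L = 1 \<and> (\<forall>M\<in>paths \<Gamma> n - {L}. f M = 0)"
    proof (rule interpolation)
      show "(\<lambda>_. 1) \<in> D"
        by (simp add: D_def path_diag_one algebra_isoD(1)[OF \<Phi>] algebra_isoD(1)[OF \<Phi>'])
      show "(\<lambda>x. f x + g x) \<in> D" "(\<lambda>x. f x * g x) \<in> D" if "f \<in> D" "g \<in> D" for f g
        using that
        by (simp_all add: D_def path_diag_add path_diag_mult[OF fin] path_diag_carrier
            algebra_isoD(4,5)[OF \<Phi>] algebra_isoD(4,5)[OF \<Phi>'])
      show "(\<lambda>x. a * f x) \<in> D" if "f \<in> D" for a f
        using that
        by (simp add: D_def path_diag_smult path_diag_carrier
            algebra_isoD(3)[OF \<Phi>] algebra_isoD(3)[OF \<Phi>'])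
      show "\<exists>f\<in>D. f L \<noteq> f M" if "M \<in> paths \<Gamma> n - {L}" for M
        using that L by (intro separated) auto
    qed (use fin in auto)
    then obtain f where f: "f \<in> D" "f L = 1" "\<forall>M\<in>paths \<Gamma> n - {L}. f M = 0"
      by blast
    \<comment> \<open>A diagonal element sees only values on paths, where \<open>f\<close> is the
      indicator of \<open>L\<close>.\<close>
    then have "path_diag \<Gamma> n f = path_unit L L"
      unfolding path_diag_unit[OF L, symmetric] by (intro path_diag_cong) auto
    then show ?thesis
      using f(1) by (simp add: D_def)
  qed
  show ?thesis
  proof (intro conjI impI ballI)
    fix x
    assume "\<forall>(M, L)\<in>path_pairs \<Gamma> n. \<Phi> (path_unit M L) = \<Phi>' (path_unit M L)"
      and "x \<in> carrier (path_algebra \<Gamma> n)"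
    then show "\<Phi> x = \<Phi>' x"
      using algebra_iso_determined_by_path_units[OF \<Phi> \<Phi>' fin] by blast
  next
    fix L assume "L \<in> paths \<Gamma> n"
    then show "\<Phi> (path_unit L L) = \<Phi>' (path_unit L L)"
      by (rule diagonal)
  next
    fix p assume p: "p \<in> path_pairs \<Gamma> n"
    obtain M L where pair: "p = (M, L)"
      by (cases p)
    have "\<exists>a. a \<noteq> 0 \<and> \<Phi> (path_unit M L) = a \<odot>\<^bsub>group_algebra G\<^esub> \<Phi>' (path_unit M L)"
      using p pair
      by (intro algebra_iso_path_unit_up_to_scalar[OF \<Phi> \<Phi>' fin] diagonal)
        (auto simp: path_pairs_def)
    then show "case p of (M, L) \<Rightarrow> M \<noteq> L \<longrightarrow>
        (\<exists>a. a \<noteq> 0 \<and> \<Phi> (path_unit M L) = a \<odot>\<^bsub>group_algebra G\<^esub> \<Phi>' (path_unit M L))"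
      by (simp add: pair)
  qed
qed

end
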